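(* Let $H$ be a complex separable infinite-dimensional Hilbert space. For every $M>1$, the set $$\operatorname{RRec}_M^{\neq\varnothing}(H)=\{T\in\mathcal{L}_M(H): \operatorname{RRec}(T)\setminus\{0\}\neq\varnothing\}$$ is meager in $(\mathcal{L}_M(H),\mathrm{SOT}^* )$.
   Context: $\mathcal{L}(H)$ is the set of bounded linear operators on $H$, and $\mathcal{L}_M(H)=\{T\in\mathcal{L}(H):\|T\|\le M\}$. The Strong$^*$ Operator Topology (SOT$^*$) is the topology in which a basis of neighbourhoods of $T_0$ is given by the sets $\{T:\|(T-T_0)x_i\|<\varepsilon\text{ and }\|(T-T_0)^*x_i\|<\varepsilon\text{ for }i=1,\dots,s\}$ with $x_1,\dots,x_s\in H$, $\varepsilon>0$; $\mathcal{L}_M(H)$ carries the induced topology (which is Polish). $N(x,U)=\{n\in\mathbb{N}_0:T^nx\in U\}$, with $\mathbb{N}_0=\{0,1,2,\dots\}$. The upper Banach density of $A\subset\mathbb{N}_0$ is $\overline{\operatorname{Bd}}(A)=\limsup_{N\to\infty}\left(\max_{m\ge0}\frac{\operatorname{card}(A\cap[m,m+N])}{N+1}\right)$. $\operatorname{RRec}(T)$ is the set of reiteratively recurrent vectors of $T$, i.e. those $x\in H$ with $\overline{\operatorname{Bd}}(N(x,U))>0$ for every norm neighbourhood $U$ of $x$. *)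

theory Defs
  imports "HOL-Analysis.Analysis"
begin

(* A complex inner product space, built on top of the library class real_inner so that
   the norm, the metric topology and completeness are those of the library.  The inner
   product is linear in its first argument; its real part is the real inner product,
   hence cinner x x = (norm x)^2, and positive definiteness comes from real_inner.
   A complex Hilbert space is a type of sort {complex_inner, complete_space}. *)

class complex_inner = real_inner +
  fixes scaleC :: "complex \<Rightarrow> 'a \<Rightarrow> 'a"
    and cinner :: "'a \<Rightarrow> 'a \<Rightarrow> complex"
  assumes scaleC_add_right: "scaleC c (x + y) = scaleC c x + scaleC c y"
    and scaleC_add_left: "scaleC (c + d) x = scaleC c x + scaleC d x"
    and scaleC_scaleC: "scaleC c (scaleC d x) = scaleC (c * d) x"
    and scaleC_of_real: "scaleC (complex_of_real r) x = r *\<^sub>R x"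
    and cinner_commute: "cinner x y = cnj (cinner y x)"
    and cinner_add_left: "cinner (x + y) z = cinner x z + cinner y z"
    and cinner_scaleC_left: "cinner (scaleC c x) y = c * cinner x y"
    and Re_cinner: "Re (cinner x y) = inner x y"

global_interpretation complex_vector:
  vector_space "scaleC :: complex \<Rightarrow> 'a \<Rightarrow> 'a::complex_inner"
  defines cspan = complex_vector.span
  by unfold_locales
    (simp_all add: scaleC_add_right scaleC_add_left scaleC_scaleC
      scaleC_of_real[of 1, simplified])

lemma cinner_self: "cinner x x = complex_of_real ((norm x)\<^sup>2)"
proof -
  have "Im (cinner x x) = 0"
    using arg_cong[OF cinner_commute[of x x], of Im] by simp
  then show ?thesis
    by (simp add: complex_eq_iff Re_cinner power2_norm_eq_inner)
qed

(* L(H): a real-linear bounded operator that commutes with complex scalars.  The norm of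
   the library type of bounded linear maps is the operator norm, which does not depend on
   whether the scalars are real or complex. *)

definition bounded_ops :: "('h::complex_inner \<Rightarrow>\<^sub>L 'h) set" where
  "bounded_ops = {T. \<forall>c x. blinfun_apply T (scaleC c x) = scaleC c (blinfun_apply T x)}"

definition bounded_ops_ball :: "real \<Rightarrow> ('h::complex_inner \<Rightarrow>\<^sub>L 'h) set" where
  "bounded_ops_ball M = {T \<in> bounded_ops. norm T \<le> M}"

definition hadjoint :: "('h::complex_inner \<Rightarrow>\<^sub>L 'h) \<Rightarrow> ('h \<Rightarrow>\<^sub>L 'h)" where
  "hadjoint T = (THE S. S \<in> bounded_ops \<and>
     (\<forall>x y. cinner (blinfun_apply T x) y = cinner x (blinfun_apply S y)))"

definition sot_star_nbhd ::
    "('h::complex_inner \<Rightarrow>\<^sub>L 'h) \<Rightarrow> 'h set \<Rightarrow> real \<Rightarrow> ('h \<Rightarrow>\<^sub>L 'h) set" where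
  "sot_star_nbhd T0 F \<epsilon> = {T \<in> bounded_ops. \<forall>x\<in>F.
     norm (blinfun_apply (T - T0) x) < \<epsilon> \<and> norm (blinfun_apply (hadjoint (T - T0)) x) < \<epsilon>}"

definition sot_star :: "('h::complex_inner \<Rightarrow>\<^sub>L 'h) topology" where
  "sot_star = topology (\<lambda>W. W \<subseteq> bounded_ops \<and>
     (\<forall>T0\<in>W. \<exists>F \<epsilon>. finite F \<and> 0 < \<epsilon> \<and> sot_star_nbhd T0 F \<epsilon> \<subseteq> W))"

definition nowhere_dense_in :: "'a topology \<Rightarrow> 'a set \<Rightarrow> bool" where
  "nowhere_dense_in X S \<longleftrightarrow> S \<subseteq> topspace X \<and> X interior_of (X closure_of S) = {}"

definition meager_in :: "'a topology \<Rightarrow> 'a set \<Rightarrow> bool" where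
  "meager_in X S \<longleftrightarrow> (\<exists>\<N>. countable \<N> \<and> (\<forall>A\<in>\<N>. nowhere_dense_in X A) \<and> S = \<Union>\<N>)"

(* The maximum is over a finite set of values, see finite_window_counts below. *)
definition upper_banach_density :: "nat set \<Rightarrow> ereal" where
  "upper_banach_density A = limsup (\<lambda>N.
     ereal (Max (range (\<lambda>m. real (card (A \<inter> {m..m + N})) / real (N + 1)))))"

definition return_times :: "('a \<Rightarrow> 'a) \<Rightarrow> 'a \<Rightarrow> 'a set \<Rightarrow> nat set" where
  "return_times f x U = {n. (f ^^ n) x \<in> U}"

definition RRec :: "('h::complex_inner \<Rightarrow>\<^sub>L 'h) \<Rightarrow> 'h set" where
  "RRec T = {x. \<forall>U. x \<in> interior U \<longrightarrow>
     0 < upper_banach_density (return_times (blinfun_apply T) x U)}"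

lemma riesz_real:
  fixes f :: "'a::{real_inner, complete_space} \<Rightarrow> real"
  assumes "bounded_linear f"
  obtains z where "\<And>x. f x = inner x z"
proof -
  interpret f: bounded_linear f by fact
  define J where "J x = 2 * f x - (norm x)\<^sup>2" for x
  obtain K where K: "\<And>x. norm (f x) \<le> norm x * K"
    using f.bounded by blast
  have J_le: "J x \<le> K\<^sup>2" for x
  proof -
    have "f x \<le> norm x * K" using K[of x] by simp
    moreover have "0 \<le> (norm x - K)\<^sup>2" by simp
    ultimately show ?thesis by (simp add: J_def power2_diff)
  qed
  then have bdd: "bdd_above (range J)" by (intro bdd_aboveI2)
  define s where "s = (SUP x. J x)"
  have J_s: "J x \<le> s" for x
    unfolding s_def by (rule cSUP_upper[OF _ bdd]) simp
  have par: "(norm (x + y))\<^sup>2 + (norm (x - y))\<^sup>2 = 2 * (norm x)\<^sup>2 + 2 * (norm y)\<^sup>2" for x y :: 'a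
    by (simp add: power2_norm_eq_inner inner_add_left inner_add_right
        inner_diff_left inner_diff_right)
  have mid: "J ((1/2) *\<^sub>R (x + y)) = (J x + J y) / 2 + (norm (x - y))\<^sup>2 / 4" for x y
  proof -
    have "J ((1/2) *\<^sub>R w) = f w - (norm w)\<^sup>2 / 4" for w
      by (simp add: J_def f.scaleR power_divide)
    from this[of "x + y"] show ?thesis
      using par[of x y] J_def[of x] J_def[of y] unfolding f.add by argo
  qed
  have "\<exists>x. s - 1 / real (Suc n) < J x" for n
  proof -
    have "s - 1 / real (Suc n) < (SUP x. J x)" by (simp add: s_def)
    then show ?thesis using less_cSUP_iff[OF _ bdd] by blast
  qed
  then obtain X where X: "\<And>n. s - 1 / real (Suc n) < J (X n)" by metis
  have dist_X: "(norm (X m - X n))\<^sup>2 \<le> 2 * (1 / real (Suc m)) + 2 * (1 / real (Suc n))" for m n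
    using J_s[of "(1/2) *\<^sub>R (X m + X n)"] X[of m] X[of n] mid[of "X m" "X n"] by argo
  have "Cauchy X"
  proof (rule metric_CauchyI)
    fix e :: real assume e: "0 < e"
    then obtain N where N: "1 / real (Suc N) < e\<^sup>2 / 4"
      using nat_approx_posE[of "e\<^sup>2 / 4"] by auto
    have "dist (X m) (X n) < e" if "N \<le> m" "N \<le> n" for m n
    proof -
      have "1 / real (Suc m) \<le> 1 / real (Suc N)" "1 / real (Suc n) \<le> 1 / real (Suc N)"
        using that by (simp_all add: frac_le)
      then have "(norm (X m - X n))\<^sup>2 < e\<^sup>2"
        using dist_X[of m n] N by simp
      then show ?thesis using e by (simp add: dist_norm power2_less_imp_less)
    qed
    then show "\<exists>N. \<forall>m\<ge>N. \<forall>n\<ge>N. dist (X m) (X n) < e" by blast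
  qed
  then obtain z where z: "X \<longlonglongrightarrow> z"
    using Cauchy_convergent_iff convergent_def by blast
  have "(\<lambda>n. J (X n)) \<longlonglongrightarrow> J z"
    unfolding J_def by (intro tendsto_intros f.tendsto z)
  moreover have "(\<lambda>n. s - 1 / real (Suc n)) \<longlonglongrightarrow> s - 0"
    by (intro tendsto_diff tendsto_const LIMSEQ_Suc[OF lim_1_over_n])
  ultimately have "s - 0 \<le> J z"
    using X by (intro LIMSEQ_le[of _ "s - 0" "\<lambda>n. J (X n)"]) (auto intro: less_imp_le)
  then have J_z: "J x \<le> J z" for x using J_s[of x] by simp
  have "f x = inner x z" for x
  proof (rule ccontr)
    assume "f x \<noteq> inner x z"
    define a where "a = f x - inner x z"
    define q where "q = (norm x)\<^sup>2 + 1"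
    have a: "a \<noteq> 0" using \<open>f x \<noteq> inner x z\<close> by (simp add: a_def)
    have q: "q > 0" by (simp add: q_def add_nonneg_pos)
    have "J (z + t *\<^sub>R x) = J z + 2 * t * a - t\<^sup>2 * (norm x)\<^sup>2" for t
      by (simp add: J_def a_def f.add f.scaleR power2_norm_eq_inner inner_add_left
          inner_add_right inner_commute[of z x]) (simp add: algebra_simps power2_eq_square)
    then have "2 * (a / q) * a - (a / q)\<^sup>2 * (norm x)\<^sup>2 \<le> 0"
      using J_z[of "z + (a / q) *\<^sub>R x"] by simp
    moreover have "(a / q)\<^sup>2 * (norm x)\<^sup>2 \<le> (a / q)\<^sup>2 * q"
      by (intro mult_left_mono) (simp_all add: q_def)
    moreover have "(a / q)\<^sup>2 * q = a\<^sup>2 / q" "2 * (a / q) * a = 2 * (a\<^sup>2 / q)"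
      using q by (simp_all add: power2_eq_square)
    moreover have "a\<^sup>2 / q > 0" using a q by simp
    ultimately show False by linarith
  qed
  then show thesis by (rule that)
qed

lemma cinner_eqI:
  fixes u v u' v' :: "'h::complex_inner"
  assumes "\<And>c. inner (scaleC c u) v = inner (scaleC c u') v'"
  shows "cinner u v = cinner u' v'"
proof -
  have "Re (c * cinner u v) = Re (c * cinner u' v')" for c
    using assms[of c] by (simp flip: Re_cinner add: cinner_scaleC_left)
  from this[of 1] this[of "- \<i>"] show ?thesis by (simp add: complex_eq_iff)
qed

lemma cinner_add_right: "cinner x (y + z) = cinner x y + cinner x z"
  using cinner_add_left[of y z x] cinner_commute[of x] by simp

lemma cinner_scaleC_right: "cinner x (scaleC c y) = cnj c * cinner x y"
  using cinner_scaleC_left[of c y x] cinner_commute[of x] by simp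

lemma cinner_right_ext:
  fixes u v :: "'h::complex_inner"
  assumes "\<And>x. cinner x u = cinner x v"
  shows "u = v"
proof -
  have "inner (u - v) (u - v) = 0"
    using arg_cong[OF assms[of "u - v"], of Re] by (simp add: Re_cinner inner_diff_right)
  then show ?thesis by simp
qed

lemma hadjoint_exists:
  fixes T :: "'h::{complex_inner, complete_space} \<Rightarrow>\<^sub>L 'h"
  assumes T: "T \<in> bounded_ops"
  shows "\<exists>!S. S \<in> bounded_ops \<and>
    (\<forall>x y. cinner (blinfun_apply T x) y = cinner x (blinfun_apply S y))"
proof -
  have "\<exists>z. \<forall>x. inner (blinfun_apply T x) y = inner x z" for y
  proof -
    have "bounded_linear (\<lambda>x. inner (blinfun_apply T x) y)"
      by (intro bounded_linear_inner_left_comp blinfun.bounded_linear_right)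
    from riesz_real[OF this] show ?thesis by metis
  qed
  then obtain g where g: "\<And>x y. inner (blinfun_apply T x) y = inner x (g y)" by metis
  have cg: "cinner (blinfun_apply T x) y = cinner x (g y)" for x y
    by (rule cinner_eqI) (use T in \<open>simp add: bounded_ops_def flip: g\<close>)
  have g_add: "g (x + y) = g x + g y" for x y
    by (rule cinner_right_ext) (simp add: cinner_add_right flip: cg)
  have g_scaleC: "g (scaleC c x) = scaleC c (g x)" for c x
    by (rule cinner_right_ext) (simp add: cinner_scaleC_right flip: cg)
  have g_norm: "norm (g y) \<le> norm y * norm T" for y
  proof (cases "g y = 0")
    case False
    have "(norm (g y))\<^sup>2 = inner (blinfun_apply T (g y)) y"
      by (simp add: g power2_norm_eq_inner)
    also have "\<dots> \<le> norm (blinfun_apply T (g y)) * norm y" by (rule norm_cauchy_schwarz)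
    also have "\<dots> \<le> norm T * norm (g y) * norm y"
      by (intro mult_right_mono norm_blinfun) simp
    finally show ?thesis using False by (simp add: power2_eq_square mult_ac)
  qed simp
  have g_bl: "bounded_linear g"
  proof (rule bounded_linear_intro)
    show "g (r *\<^sub>R x) = r *\<^sub>R g x" for r x
      using g_scaleC[of "complex_of_real r" x] by (simp add: scaleC_of_real)
  qed (use g_add g_norm in auto)
  show ?thesis
  proof (rule ex1I[of _ "Blinfun g"])
    show "Blinfun g \<in> bounded_ops \<and>
        (\<forall>x y. cinner (blinfun_apply T x) y = cinner x (blinfun_apply (Blinfun g) y))"
      by (simp add: bounded_ops_def bounded_linear_Blinfun_apply[OF g_bl] g_scaleC cg)
  next
    fix S assume "S \<in> bounded_ops \<and>
        (\<forall>x y. cinner (blinfun_apply T x) y = cinner x (blinfun_apply S y))"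
    then have "blinfun_apply S y = g y" for y
      using cg by (intro cinner_right_ext) metis
    then show "S = Blinfun g"
      by (intro blinfun_eqI) (simp add: bounded_linear_Blinfun_apply[OF g_bl])
  qed
qed

lemma finite_window_counts:
  "finite (range (\<lambda>m. real (card (A \<inter> {m..m + N})) / real (N + 1)))"
proof (rule finite_subset)
  have "card (A \<inter> {m..m + N}) \<le> N + 1" for m
    using card_mono[of "{m..m + N}" "A \<inter> {m..m + N}"] by simp
  then show "range (\<lambda>m. real (card (A \<inter> {m..m + N})) / real (N + 1))
      \<subseteq> (\<lambda>k. real k / real (N + 1)) ` {..N + 1}"
    by blast
qed simp

lemma sot_star_nbhd_mono:
  "F \<subseteq> G \<Longrightarrow> \<delta> \<le> \<epsilon> \<Longrightarrow> sot_star_nbhd T0 G \<delta> \<subseteq> sot_star_nbhd T0 F \<epsilon>"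
  unfolding sot_star_nbhd_def by fastforce

lemma openin_sot_star:
  "openin sot_star W \<longleftrightarrow> W \<subseteq> bounded_ops \<and>
     (\<forall>T0\<in>W. \<exists>F \<epsilon>. finite F \<and> 0 < \<epsilon> \<and> sot_star_nbhd T0 F \<epsilon> \<subseteq> W)"
proof -
  let ?P = "\<lambda>W. W \<subseteq> bounded_ops \<and>
     (\<forall>T0\<in>W. \<exists>F \<epsilon>. finite F \<and> (0::real) < \<epsilon> \<and> sot_star_nbhd T0 F \<epsilon> \<subseteq> W)"
  have int: "?P (V \<inter> W)" if V: "?P V" and W: "?P W" for V W
  proof (intro conjI ballI)
    show "V \<inter> W \<subseteq> bounded_ops" using V by blast
    fix T0 assume T0: "T0 \<in> V \<inter> W"
    obtain F \<epsilon> where F: "finite F" "0 < \<epsilon>" "sot_star_nbhd T0 F \<epsilon> \<subseteq> V"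
      using V T0 by blast
    obtain G \<delta> where G: "finite G" "0 < \<delta>" "sot_star_nbhd T0 G \<delta> \<subseteq> W"
      using W T0 by blast
    have "sot_star_nbhd T0 (F \<union> G) (min \<epsilon> \<delta>) \<subseteq> V \<inter> W"
      using F(3) G(3) sot_star_nbhd_mono[of F "F \<union> G" "min \<epsilon> \<delta>" \<epsilon> T0]
        sot_star_nbhd_mono[of G "F \<union> G" "min \<epsilon> \<delta>" \<delta> T0] by auto
    moreover have "finite (F \<union> G)" "0 < min \<epsilon> \<delta>" using F G by auto
    ultimately show "\<exists>F \<epsilon>. finite F \<and> 0 < \<epsilon> \<and> sot_star_nbhd T0 F \<epsilon> \<subseteq> V \<inter> W"
      by blast
  qed
  have un: "?P (\<Union>\<K>)" if K: "\<forall>W\<in>\<K>. ?P W" for \<K>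
  proof (intro conjI ballI)
    show "\<Union>\<K> \<subseteq> bounded_ops" using K by blast
    fix T0 assume "T0 \<in> \<Union>\<K>"
    then obtain W where W: "W \<in> \<K>" "T0 \<in> W" by blast
    then obtain F \<epsilon> where "finite F" "0 < \<epsilon>" "sot_star_nbhd T0 F \<epsilon> \<subseteq> W"
      using K by blast
    then show "\<exists>F \<epsilon>. finite F \<and> 0 < \<epsilon> \<and> sot_star_nbhd T0 F \<epsilon> \<subseteq> \<Union>\<K>"
      using W by blast
  qed
  have "istopology ?P"
    unfolding istopology_def using int un by blast
  then show ?thesis
    unfolding sot_star_def by (subst topology_inverse') (assumption, rule refl)
qed

lemma topspace_sot_star: "topspace sot_star = bounded_ops"
proof -
  have "openin sot_star bounded_ops"
    unfolding openin_sot_star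
    by (intro conjI ballI exI[of _ "{}"] exI[of _ "1::real"]) (auto simp: sot_star_nbhd_def)
  then show ?thesis
    by (metis openin_sot_star openin_subset openin_topspace subset_antisym)
qed

lemma bounded_ops_diff: "S \<in> bounded_ops \<Longrightarrow> T \<in> bounded_ops \<Longrightarrow> S - T \<in> bounded_ops"
  by (simp add: bounded_ops_def blinfun.diff_left complex_vector.scale_right_diff_distrib)

lemma hadjoint_diff:
  fixes S T :: "'h::{complex_inner, complete_space} \<Rightarrow>\<^sub>L 'h"
  assumes "S \<in> bounded_ops" "T \<in> bounded_ops"
  shows "hadjoint (S - T) = hadjoint S - hadjoint T"
proof -
  have adj: "cinner (blinfun_apply A x) y = cinner x (blinfun_apply (hadjoint A) y)"
    if "A \<in> bounded_ops" for A :: "'h \<Rightarrow>\<^sub>L 'h" and x y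
    using theI'[OF hadjoint_exists[OF that], folded hadjoint_def] by blast
  show ?thesis
  proof (intro blinfun_eqI cinner_right_ext)
    fix x y
    have "cinner x (blinfun_apply (hadjoint (S - T)) y) + cinner (blinfun_apply T x) y
        = cinner (blinfun_apply S x) y"
      using bounded_ops_diff[OF assms]
      by (simp flip: adj cinner_add_left add: blinfun.diff_left)
    moreover have "cinner x (blinfun_apply (hadjoint S - hadjoint T) y) + cinner (blinfun_apply T x) y
        = cinner (blinfun_apply S x) y"
      using assms by (simp add: adj blinfun.diff_left flip: cinner_add_right)
    ultimately show "cinner x (blinfun_apply (hadjoint (S - T)) y)
        = cinner x (blinfun_apply (hadjoint S - hadjoint T) y)"
      by (metis add_right_cancel)
  qed
qed

lemma openin_sot_star_nbhd:
  fixes T0 :: "'h::{complex_inner, complete_space} \<Rightarrow>\<^sub>L 'h"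
  assumes T0: "T0 \<in> bounded_ops" and F: "finite F"
  shows "openin sot_star (sot_star_nbhd T0 F \<epsilon>)"
  unfolding openin_sot_star
proof (intro conjI ballI)
  show "sot_star_nbhd T0 F \<epsilon> \<subseteq> bounded_ops" by (auto simp: sot_star_nbhd_def)
  fix T assume T: "T \<in> sot_star_nbhd T0 F \<epsilon>"
  then have T_ops: "T \<in> bounded_ops" by (simp add: sot_star_nbhd_def)
  define r where "r x = max (norm (blinfun_apply (T - T0) x))
    (norm (blinfun_apply (hadjoint (T - T0)) x))" for x
  define \<delta> where "\<delta> = Min (insert 1 ((\<lambda>x. \<epsilon> - r x) ` F))"
  have "\<delta> > 0"
    using T F by (auto simp: \<delta>_def sot_star_nbhd_def r_def)
  moreover have \<delta>: "\<delta> + r x \<le> \<epsilon>" if "x \<in> F" for x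
  proof -
    have "\<delta> \<le> \<epsilon> - r x" unfolding \<delta>_def using that F by (intro Min_le) auto
    then show ?thesis by simp
  qed
  have "sot_star_nbhd T F \<delta> \<subseteq> sot_star_nbhd T0 F \<epsilon>"
  proof
    fix S assume S: "S \<in> sot_star_nbhd T F \<delta>"
    then have S_ops: "S \<in> bounded_ops" by (simp add: sot_star_nbhd_def)
    have "norm (blinfun_apply (S - T0) x) < \<epsilon> \<and> norm (blinfun_apply (hadjoint (S - T0)) x) < \<epsilon>"
      if x: "x \<in> F" for x
    proof -
      have "norm (blinfun_apply (S - T) x) < \<delta>" "norm (blinfun_apply (hadjoint (S - T)) x) < \<delta>"
        using S x by (auto simp: sot_star_nbhd_def)
      moreover have "norm (blinfun_apply (T - T0) x) \<le> r x"
        "norm (blinfun_apply (hadjoint (T - T0)) x) \<le> r x" by (auto simp: r_def)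
      moreover have "norm (blinfun_apply (S - T0) x)
          \<le> norm (blinfun_apply (S - T) x) + norm (blinfun_apply (T - T0) x)"
        using norm_triangle_ineq[of "blinfun_apply (S - T) x" "blinfun_apply (T - T0) x"]
        by (simp add: blinfun.diff_left)
      moreover have "norm (blinfun_apply (hadjoint (S - T0)) x)
          \<le> norm (blinfun_apply (hadjoint (S - T)) x) + norm (blinfun_apply (hadjoint (T - T0)) x)"
        using norm_triangle_ineq[of "blinfun_apply (hadjoint (S - T)) x"
            "blinfun_apply (hadjoint (T - T0)) x"]
        by (simp add: blinfun.diff_left hadjoint_diff S_ops T_ops T0)
      ultimately show ?thesis using \<delta>[OF x] by linarith
    qed
    then show "S \<in> sot_star_nbhd T0 F \<epsilon>" using S_ops by (simp add: sot_star_nbhd_def)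
  qed
  ultimately show "\<exists>G \<delta>. finite G \<and> 0 < \<delta> \<and> sot_star_nbhd T G \<delta> \<subseteq> sot_star_nbhd T0 F \<epsilon>"
    using F by blast
qed

end

theory Submission
  imports Defs
begin

text \<open>
  The reason is a uniform form of expansion. Say that \<open>T\<close> expands along \<open>h\<close> at level \<open>k\<close> if there
  is a time \<open>q > 0\<close> such that \<open>k \<bar>\<langle>y, h\<rangle>\<bar> \<le> \<parallel>T\<^sup>n y\<parallel> + \<parallel>y\<parallel>\<close> for \<^emph>\<open>all\<close> vectors \<open>y\<close> and all \<open>n\<close> in the long
  interval from \<open>q\<close> to \<open>k q\<close>.

  If \<open>T\<close> expands at every level along every \<open>h\<close> in a dense set, then only \<open>0\<close> can be reiteratively
  recurrent (\<open>RRec_trivial_of_expands_along\<close>). For \<open>x \<noteq> 0\<close> take \<open>h\<close> close to \<open>x\<close> and a small ball \<open>U\<close>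
  around \<open>x\<close>. On \<open>U\<close> the norm is bounded and \<open>\<langle>y, h\<rangle>\<close> is bounded away from \<open>0\<close>. So for large \<open>k\<close> an
  orbit that is in \<open>U\<close> at some moment is outside \<open>U\<close> from \<open>q\<close> until \<open>k q\<close> steps later. Because the
  inequality is uniform in \<open>y\<close>, this applies to every return, wherever it lies in time: each window
  of length \<open>k q\<close> contains at most \<open>q\<close> return times. The upper Banach density of the return set is
  therefore at most \<open>1 / k\<close>, for all large \<open>k\<close>.

  By duality, \<open>T\<close> expands along \<open>h\<close> as soon as \<open>h\<close> has, for each \<open>n\<close> in the interval, a small
  approximate preimage under the \<open>n\<close>-th power of the adjoint. This concerns finitely many vectors,
  so it persists under small SOT\<open>\<^sup>*\<close> perturbations of \<open>T\<close>
  (\<open>expands_along_of_adjoint_pseudo_orbit\<close>). It is also dense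
  (\<open>small_backward_orbit_perturbation\<close>): since \<open>H\<close> is infinite-dimensional, there is an orthonormal
  chain \<open>e\<^sub>0, e\<^sub>1, \<dots>\<close> orthogonal to \<open>h\<close>, to the finitely many vectors on which \<open>T\<^sub>0\<close> and its
  adjoint have to be approximated, and to their images. Replace \<open>T\<^sub>0\<close> on the span of the chain by \<open>M\<close> times a shift, scale everything by a
  factor slightly below \<open>1\<close>, and couple \<open>h\<close> weakly to \<open>e\<^sub>0\<close>. The adjoint of the result
  carries \<open>e\<^sub>n\<close> down the chain and finally onto \<open>h\<close>, with a factor above \<open>1\<close> at each step along the
  chain; this is where \<open>M > 1\<close> enters. Hence the operators that fail to expand along \<open>h\<close> at level \<open>k\<close>
  are nowhere dense, and \<open>k\<close> and \<open>h\<close> range over a countable set.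
\<close>

section \<open>Operator norms and adjoints\<close>

lemma norm_blinfun_le: "norm T \<le> M \<Longrightarrow> norm (blinfun_apply T x) \<le> M * norm x"
  by (rule order_trans[OF norm_blinfun mult_right_mono]) simp_all

lemma cinner_hadjoint:
  fixes T :: "'h::{complex_inner, complete_space} \<Rightarrow>\<^sub>L 'h"
  assumes "T \<in> bounded_ops"
  shows "cinner (blinfun_apply T x) y = cinner x (blinfun_apply (hadjoint T) y)"
  using theI'[OF hadjoint_exists[OF assms], folded hadjoint_def] by blast

lemma inner_hadjoint:
  fixes T :: "'h::{complex_inner, complete_space} \<Rightarrow>\<^sub>L 'h"
  assumes "T \<in> bounded_ops"
  shows "inner (blinfun_apply T x) y = inner x (blinfun_apply (hadjoint T) y)"
  using cinner_hadjoint[OF assms] by (simp flip: Re_cinner)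

lemma inner_funpow_hadjoint:
  fixes T :: "'h::{complex_inner, complete_space} \<Rightarrow>\<^sub>L 'h"
  assumes "T \<in> bounded_ops"
  shows "inner ((blinfun_apply T ^^ n) x) y = inner x ((blinfun_apply (hadjoint T) ^^ n) y)"
  by (induction n arbitrary: y) (simp_all add: inner_hadjoint[OF assms], simp add: funpow_swap1)

lemma norm_hadjoint_le:
  fixes T :: "'h::{complex_inner, complete_space} \<Rightarrow>\<^sub>L 'h"
  assumes "T \<in> bounded_ops"
  shows "norm (blinfun_apply (hadjoint T) y) \<le> norm T * norm y"
proof (cases "blinfun_apply (hadjoint T) y = 0")
  case False
  let ?z = "blinfun_apply (hadjoint T) y"
  have "norm ?z * norm ?z = inner (blinfun_apply T ?z) y"
    by (simp add: inner_hadjoint[OF assms] power2_norm_eq_inner flip: power2_eq_square)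
  also have "\<dots> \<le> norm (blinfun_apply T ?z) * norm y" by (rule norm_cauchy_schwarz)
  also have "\<dots> \<le> norm T * norm ?z * norm y"
    by (intro mult_right_mono norm_blinfun) simp
  finally have "norm ?z * norm ?z \<le> (norm T * norm y) * norm ?z" by (simp add: mult_ac)
  then show ?thesis using False by simp
qed simp

text \<open>The adjoint at a single vector is determined by the values there, so explicit adjoints of whole
  operators need not be constructed.\<close>

lemma hadjoint_eqI:
  fixes T :: "'h::{complex_inner, complete_space} \<Rightarrow>\<^sub>L 'h"
  assumes "T \<in> bounded_ops" "\<And>x. cinner (blinfun_apply T x) y = cinner x z"
  shows "blinfun_apply (hadjoint T) y = z"
  by (rule cinner_right_ext) (use assms in \<open>simp flip: cinner_hadjoint\<close>)

section \<open>Expanding directions and reiterative recurrence\<close>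

text \<open>The bound has the term \<open>norm y\<close> on the right because it is derived from approximate preimages of
  \<open>h\<close>: the error of the approximation is paired with \<open>y\<close>. Uniformity in \<open>y\<close> is what makes
  the condition usable at every point of an orbit.\<close>

definition expands_along :: "nat \<Rightarrow> 'h \<Rightarrow> ('h::real_inner \<Rightarrow> 'h) \<Rightarrow> bool" where
  "expands_along k h f \<longleftrightarrow> (\<exists>q>0. \<forall>n\<in>{q..k * q}. \<forall>y.
     real k * \<bar>inner y h\<bar> \<le> norm ((f ^^ n) y) + norm y)"

text \<open>In a window of length \<open>p\<close>, everything lies within \<open>q\<close> of the first element; longer windows are
  cut into pieces of length \<open>p\<close>.\<close>

lemma card_inter_window_le:
  fixes A :: "nat set"
  assumes gap: "\<And>n j. n \<in> A \<Longrightarrow> j \<in> {q..p} \<Longrightarrow> n + j \<notin> A"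
  shows "card (A \<inter> {m..<m + l * p}) \<le> l * q"
proof (induction l)
  case (Suc l)
  let ?W = "A \<inter> {m + l * p..<m + l * p + p}"
  have "card ?W \<le> q"
  proof (cases "?W = {}")
    case False
    define a where "a = (LEAST a. a \<in> ?W)"
    have a: "a \<in> ?W" unfolding a_def using False by (intro LeastI_ex[of "\<lambda>a. a \<in> ?W"]) blast
    have "?W \<subseteq> {a..<a + q}"
    proof
      fix b assume b: "b \<in> ?W"
      then have "a \<le> b" unfolding a_def by (rule Least_le[of "\<lambda>a. a \<in> ?W"])
      moreover have "b < a + q"
      proof (rule ccontr)
        assume "\<not> b < a + q"
        then have "b - a \<in> {q..p}" using a b by auto
        then show False using gap[of a "b - a"] a b \<open>a \<le> b\<close> by auto
      qed
      ultimately show "b \<in> {a..<a + q}" by simp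
    qed
    from card_mono[OF _ this] show ?thesis by simp
  qed simp
  moreover have "A \<inter> {m..<m + Suc l * p} = (A \<inter> {m..<m + l * p}) \<union> ?W"
    by auto
  ultimately show ?case
    using Suc card_Un_le[of "A \<inter> {m..<m + l * p}" ?W] by simp
qed simp

text \<open>A window of length \<open>N + 1\<close> is covered by \<open>(N + 1) div (k q) + 1\<close> windows of length \<open>k q\<close>, each
  with at most \<open>q\<close> elements. The one surplus window contributes \<open>q / (N + 1)\<close>, which vanishes in the
  limit.\<close>

lemma upper_banach_density_gap:
  fixes A :: "nat set"
  assumes "k > 0" "q > 0"
    and gap: "\<And>n j. n \<in> A \<Longrightarrow> j \<in> {q..k * q} \<Longrightarrow> n + j \<notin> A"
  shows "upper_banach_density A \<le> ereal (1 / real k)"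
proof -
  have bound: "real (card (A \<inter> {m..m + N})) / real (N + 1) \<le> 1 / real k + real q / real (N + 1)"
    for m N
  proof -
    define l where "l = (N + 1) div (k * q)"
    have p: "k * q > 0" using assms by simp
    have "N + 1 = l * (k * q) + (N + 1) mod (k * q)" unfolding l_def by (rule div_mod_decomp)
    then have N: "N + 1 < Suc l * (k * q)" and lN: "l * (k * q) \<le> N + 1"
      using mod_less_divisor[OF p, of "N + 1"] by simp_all
    have "A \<inter> {m..m + N} \<subseteq> A \<inter> {m..<m + Suc l * (k * q)}"
      using N by auto
    then have "card (A \<inter> {m..m + N}) \<le> card (A \<inter> {m..<m + Suc l * (k * q)})"
      by (intro card_mono) auto
    also have "\<dots> \<le> Suc l * q" by (rule card_inter_window_le[OF gap])
    finally have "real (card (A \<inter> {m..m + N})) \<le> real (Suc l * q)"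
      by (simp only: of_nat_le_iff)
    then have "real (card (A \<inter> {m..m + N})) \<le> real l * real q + real q"
      by (simp add: algebra_simps)
    moreover have "real l * real q \<le> real (N + 1) / real k"
      using lN assms(1) by (simp add: pos_le_divide_eq mult_ac flip: of_nat_mult)
    ultimately have "real (card (A \<inter> {m..m + N})) \<le> real (N + 1) / real k + real q"
      by linarith
    then have "real (card (A \<inter> {m..m + N})) / real (N + 1)
        \<le> (real (N + 1) / real k + real q) / real (N + 1)"
      by (intro divide_right_mono) simp_all
    also have "\<dots> = 1 / real k + real q / real (N + 1)"
      by (simp add: add_divide_distrib del: of_nat_add of_nat_Suc)
    finally show ?thesis .
  qed
  have "upper_banach_density A \<le> limsup (\<lambda>N. ereal (1 / real k + real q / real (N + 1)))"
    unfolding upper_banach_density_def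
    by (intro Limsup_mono always_eventually allI)
      (use finite_window_counts in \<open>auto intro!: Max.boundedI bound[simplified]\<close>)
  also have "\<dots> = ereal (1 / real k)"
  proof (rule lim_imp_Limsup)
    have "(\<lambda>N. real q / real (N + 1)) \<longlonglongrightarrow> 0"
      using LIMSEQ_Suc[OF lim_const_over_n[of "real q"]] by simp
    then have "(\<lambda>N. 1 / real k + real q / real (N + 1)) \<longlonglongrightarrow> 1 / real k + 0"
      by (intro tendsto_add tendsto_const)
    then show "(\<lambda>N. ereal (1 / real k + real q / real (N + 1))) \<longlonglongrightarrow> ereal (1 / real k)"
      by (simp only: add_0_right lim_ereal)
  qed simp
  finally show ?thesis .
qed

text \<open>The ball has radius \<open>r / 4\<close> and \<open>h\<close> is within \<open>r / 4\<close> of \<open>x\<close>, where \<open>r\<close> is the norm of \<open>x\<close>. Two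
  points \<open>y\<close> and \<open>T\<^sup>j y\<close> of the ball then have norm at most \<open>5 r / 4\<close> while \<open>\<langle>y, h\<rangle>\<close> is at least
  \<open>7 r\<^sup>2 / 16\<close>, so the expansion inequality for \<open>j\<close> fails once \<open>k > 40 / (7 r)\<close>.\<close>

lemma RRec_trivial_of_expands_along:
  fixes T :: "'h::complex_inner \<Rightarrow>\<^sub>L 'h"
  assumes dense: "closure D = (UNIV :: 'h set)"
    and expands: "\<And>k h. h \<in> D \<Longrightarrow> expands_along k h (blinfun_apply T)"
  shows "RRec T - {0} = {}"
proof -
  have "x = 0" if x: "x \<in> RRec T" for x
  proof (rule ccontr)
    assume "x \<noteq> 0"
    define r where "r = norm x"
    have r: "r > 0" using \<open>x \<noteq> 0\<close> by (simp add: r_def)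
    define U where "U = ball x (r / 4)"
    define A where "A = return_times (blinfun_apply T) x U"
    have "\<exists>h\<in>D. dist h x < r / 4"
      using dense r by (metis UNIV_I closure_approachable divide_pos_pos zero_less_numeral)
    then obtain h where h: "h \<in> D" "norm (h - x) < r / 4" by (auto simp: dist_norm)
    have inner_U: "7 / 16 * r\<^sup>2 \<le> \<bar>inner y h\<bar>" if "y \<in> U" for y
    proof -
      have "norm (y - x) < r / 4" using that by (simp add: U_def dist_norm norm_minus_commute)
      have "norm h \<le> 5 / 4 * r"
        using norm_triangle_ineq[of x "h - x"] h(2) by (simp add: r_def)
      have "\<bar>inner (y - x) h\<bar> \<le> norm (y - x) * norm h" by (rule Cauchy_Schwarz_ineq2)
      also have "\<dots> \<le> (r / 4) * (5 / 4 * r)"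
        using \<open>norm (y - x) < r / 4\<close> \<open>norm h \<le> 5 / 4 * r\<close> r by (intro mult_mono) auto
      finally have 1: "\<bar>inner (y - x) h\<bar> \<le> 5 / 16 * r\<^sup>2" by (simp add: power2_eq_square)
      have "\<bar>inner x (h - x)\<bar> \<le> norm x * norm (h - x)" by (rule Cauchy_Schwarz_ineq2)
      also have "\<dots> \<le> r * (r / 4)"
        using h(2) r by (intro mult_mono) (auto simp: r_def)
      finally have 2: "\<bar>inner x (h - x)\<bar> \<le> 1 / 4 * r\<^sup>2" by (simp add: power2_eq_square)
      have "inner y h = r\<^sup>2 + inner (y - x) h + inner x (h - x)"
        by (simp add: inner_diff_left inner_diff_right r_def power2_norm_eq_inner)
      then show ?thesis using 1 2 by linarith
    qed
    have norm_U: "norm y \<le> 5 / 4 * r" if "y \<in> U" for y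
      using that norm_triangle_ineq[of x "y - x"]
      by (simp add: U_def r_def dist_norm norm_minus_commute)
    have density: "upper_banach_density A \<le> ereal (1 / real k)" if k: "real k > 40 / (7 * r)" for k
    proof -
      obtain q where q: "q > 0" and exp: "\<And>n y. n \<in> {q..k * q} \<Longrightarrow>
          real k * \<bar>inner y h\<bar> \<le> norm ((blinfun_apply T ^^ n) y) + norm y"
        using expands[OF h(1), of k] unfolding expands_along_def by blast
      have "40 / (7 * r) > 0" using r by simp
      then have "k > 0" using k by (cases k) auto
      moreover have "n + j \<notin> A" if n: "n \<in> A" and j: "j \<in> {q..k * q}" for n j
      proof
        assume "n + j \<in> A"
        let ?y = "(blinfun_apply T ^^ n) x"
        have y: "?y \<in> U" using n by (simp add: A_def return_times_def)
        have Ty: "(blinfun_apply T ^^ j) ?y \<in> U"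
          using \<open>n + j \<in> A\<close>
          by (simp add: A_def return_times_def add.commute[of n j] funpow_add)
        have "real k * (7 / 16 * r\<^sup>2) \<le> real k * \<bar>inner ?y h\<bar>"
          using inner_U[OF y] by (intro mult_left_mono) auto
        also have "\<dots> \<le> 5 / 2 * r"
          using exp[OF j, of ?y] norm_U[OF y] norm_U[OF Ty] by linarith
        finally have "(real k * (7 * r)) * r \<le> 40 * r" by (simp add: power2_eq_square mult_ac)
        then have "real k * (7 * r) \<le> 40" using r by simp
        then show False using k r by (simp add: pos_divide_less_eq)
      qed
      ultimately show ?thesis using q upper_banach_density_gap by blast
    qed
    have "upper_banach_density A \<le> 0"
    proof (rule ereal_le_epsilon2)
      fix e :: real assume e: "0 < e"
      obtain k :: nat where k: "real k > max (40 / (7 * r)) (1 / e)"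
        using reals_Archimedean2 by blast
      have "1 / e < real k" "1 / e > 0" using k e by simp_all
      then have "real k > 0" by linarith
      with \<open>1 / e < real k\<close> have "1 / real k \<le> e"
        using e by (simp add: pos_divide_less_eq pos_divide_le_eq mult.commute)
      then show "upper_banach_density A \<le> 0 + ereal e"
        using density[of k] k by (simp add: order_trans)
    qed
    moreover have "0 < upper_banach_density A"
    proof -
      have "x \<in> interior U" using r by (simp add: U_def)
      then show ?thesis using x unfolding RRec_def A_def by blast
    qed
    ultimately show False by simp
  qed
  then show ?thesis by blast
qed

section \<open>Expansion from small backward pseudo-orbits of the adjoint\<close>

text \<open>One step of the backward pseudo-orbit makes an error of at most \<open>\<delta>\<close>, and the remaining steps
  enlarge that error by a factor of at most \<open>M\<close> each.\<close>

lemma norm_funpow_pseudo_orbit_le: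
  fixes T :: "'a::real_normed_vector \<Rightarrow>\<^sub>L 'a"
  assumes T: "\<And>x. norm (blinfun_apply T x) \<le> M * norm x" and "1 \<le> M" "0 \<le> \<delta>"
    and "\<And>j. j < n \<Longrightarrow> norm (blinfun_apply T (u (Suc j)) - u j) \<le> \<delta>"
  shows "norm ((blinfun_apply T ^^ n) (u n) - u 0) \<le> real n * M ^ n * \<delta>"
  using assms(4)
proof (induction n)
  case (Suc n)
  have pow_le: "norm ((blinfun_apply T ^^ n) x) \<le> M ^ n * norm x" for x
  proof (induction n)
    case (Suc n)
    have "norm ((blinfun_apply T ^^ Suc n) x) \<le> M * norm ((blinfun_apply T ^^ n) x)"
      using T by simp
    also have "\<dots> \<le> M * (M ^ n * norm x)"
      using Suc \<open>1 \<le> M\<close> by (intro mult_left_mono) auto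
    finally show ?case by (simp add: mult_ac)
  qed simp
  have pow_diff: "(blinfun_apply T ^^ n) (x - y) = (blinfun_apply T ^^ n) x - (blinfun_apply T ^^ n) y"
    for x y by (induction n) (simp_all add: blinfun.diff_right)
  have "(blinfun_apply T ^^ Suc n) (u (Suc n)) - u 0
      = (blinfun_apply T ^^ n) (blinfun_apply T (u (Suc n)) - u n)
        + ((blinfun_apply T ^^ n) (u n) - u 0)"
    by (simp add: pow_diff funpow_swap1)
  also have "norm \<dots> \<le> M ^ n * \<delta> + real n * M ^ n * \<delta>"
  proof (intro norm_triangle_mono)
    show "norm ((blinfun_apply T ^^ n) (blinfun_apply T (u (Suc n)) - u n)) \<le> M ^ n * \<delta>"
      using pow_le[of "blinfun_apply T (u (Suc n)) - u n"] Suc.prems[of n] \<open>1 \<le> M\<close>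
      by (meson lessI mult_left_mono order_trans zero_le_power zero_le_one)
  qed (use Suc in simp)
  also have "\<dots> = (real (Suc n) * \<delta>) * M ^ n" by (simp add: algebra_simps)
  also have "\<dots> \<le> (real (Suc n) * \<delta>) * M ^ Suc n"
    using \<open>1 \<le> M\<close> \<open>0 \<le> \<delta>\<close> by (intro mult_left_mono power_increasing) auto
  finally show ?case by (simp add: mult_ac)
qed simp

text \<open>Write \<open>h\<close> as \<open>S\<^sup>n (u n)\<close> minus a small error, where \<open>S\<close> is the adjoint. Pairing with \<open>y\<close>
  moves \<open>S\<^sup>n\<close> over to \<open>T\<^sup>n y\<close>, and the small norm of \<open>u n\<close> becomes the large factor \<open>k\<close>. Within
  the ball of radius \<open>M\<close>, the hypotheses on \<open>T\<close> involve its adjoint at finitely many vectors only, so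
  they hold for all operators in a strong\<open>\<^sup>*\<close> neighbourhood of one with an exact backward orbit.\<close>

lemma expands_along_of_adjoint_pseudo_orbit:
  fixes T :: "'h::{complex_inner, complete_space} \<Rightarrow>\<^sub>L 'h"
  assumes T: "T \<in> bounded_ops_ball M" and "1 \<le> M" and q: "q > 0"
    and u0: "u 0 = h"
    and small: "\<And>n. n \<in> {q..k * q} \<Longrightarrow> real k * norm (u n) \<le> 1"
    and \<delta>: "0 \<le> \<delta>" "real k * (real (k * q) * M ^ (k * q) * \<delta>) \<le> 1"
    and orbit: "\<And>j. j < k * q \<Longrightarrow> norm (blinfun_apply (hadjoint T) (u (Suc j)) - u j) \<le> \<delta>"
  shows "expands_along k h (blinfun_apply T)"
  unfolding expands_along_def
proof (intro exI[of _ q] conjI ballI allI q)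
  fix n y assume n: "n \<in> {q..k * q}"
  have Tops: "T \<in> bounded_ops" and "norm T \<le> M" using T by (auto simp: bounded_ops_ball_def)
  let ?S = "blinfun_apply (hadjoint T)"
  have "norm (?S x) \<le> M * norm x" for x
    using norm_hadjoint_le[OF Tops, of x] \<open>norm T \<le> M\<close>
    by (meson mult_right_mono norm_ge_zero order_trans)
  then have "norm ((?S ^^ n) (u n) - h) \<le> real n * M ^ n * \<delta>"
    unfolding u0[symmetric] using n
    by (intro norm_funpow_pseudo_orbit_le \<open>1 \<le> M\<close> \<delta>(1) orbit) auto
  also have "\<dots> \<le> real (k * q) * M ^ (k * q) * \<delta>"
    using n \<open>1 \<le> M\<close> \<delta>(1)
    by (intro mult_right_mono mult_mono power_increasing) (auto simp del: of_nat_mult)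
  finally have "real k * norm ((?S ^^ n) (u n) - h)
      \<le> real k * (real (k * q) * M ^ (k * q) * \<delta>)"
    by (intro mult_left_mono) auto
  then have near: "real k * norm ((?S ^^ n) (u n) - h) \<le> 1"
    using \<delta>(2) by linarith
  have "inner y h = inner ((blinfun_apply T ^^ n) y) (u n) - inner y ((?S ^^ n) (u n) - h)"
    by (simp add: inner_funpow_hadjoint[OF Tops] inner_diff_right)
  then have "\<bar>inner y h\<bar> \<le> \<bar>inner ((blinfun_apply T ^^ n) y) (u n)\<bar>
      + \<bar>inner y ((?S ^^ n) (u n) - h)\<bar>"
    by linarith
  also have "\<dots> \<le> norm ((blinfun_apply T ^^ n) y) * norm (u n)
      + norm y * norm ((?S ^^ n) (u n) - h)"
    by (intro add_mono Cauchy_Schwarz_ineq2)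
  finally have "real k * \<bar>inner y h\<bar> \<le> real k * (norm ((blinfun_apply T ^^ n) y) * norm (u n)
      + norm y * norm ((?S ^^ n) (u n) - h))"
    by (intro mult_left_mono) auto
  also have "\<dots> = norm ((blinfun_apply T ^^ n) y) * (real k * norm (u n))
      + norm y * (real k * norm ((?S ^^ n) (u n) - h))"
    by (simp add: algebra_simps)
  also have "\<dots> \<le> norm ((blinfun_apply T ^^ n) y) * 1 + norm y * 1"
    using small[OF n] near by (intro add_mono mult_left_mono) auto
  finally show "real k * \<bar>inner y h\<bar> \<le> norm ((blinfun_apply T ^^ n) y) + norm y" by simp
qed

section \<open>Orthonormal systems\<close>

lemma cinner_zero_left [simp]: "cinner (0::'h::complex_inner) y = 0"
  using cinner_add_left[of 0 0 y] by simp

lemma cinner_zero_right [simp]: "cinner y (0::'h::complex_inner) = 0"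
  using cinner_add_right[of y 0 0] by simp

lemma cinner_scaleR_left: "cinner (r *\<^sub>R x) y = complex_of_real r * cinner x y"
  by (simp flip: scaleC_of_real add: cinner_scaleC_left)

lemma cinner_scaleR_right: "cinner x (r *\<^sub>R y) = complex_of_real r * cinner x y"
  by (simp flip: scaleC_of_real add: cinner_scaleC_right)

lemma cinner_diff_left: "cinner (x - y) z = cinner x z - cinner y z"
  using cinner_add_left[of "x - y" y z] by simp

lemma cinner_diff_right: "cinner x (y - z) = cinner x y - cinner x z"
  using cinner_add_right[of x "y - z" z] by simp

lemma cinner_sum_left: "cinner (\<Sum>i\<in>I. f i) y = (\<Sum>i\<in>I. cinner (f i) y)"
  by (induction I rule: infinite_finite_induct) (simp_all add: cinner_add_left)

lemma cinner_eq_zero_commute: "cinner x y = 0 \<longleftrightarrow> cinner y x = 0"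
  by (metis cinner_commute complex_cnj_zero)

lemma norm_scaleC: "norm (scaleC c x) = cmod c * norm x"
proof -
  have "cinner (scaleC c x) (scaleC c x) = (c * cnj c) * cinner x x"
    by (simp add: cinner_scaleC_left cinner_scaleC_right)
  also have "\<dots> = complex_of_real ((cmod c * norm x)\<^sup>2)"
    by (simp only: cinner_self power_mult_distrib of_real_mult flip: complex_norm_square)
  finally have "(norm (scaleC c x))\<^sup>2 = (cmod c * norm x)\<^sup>2"
    by (simp only: cinner_self of_real_eq_iff)
  then show ?thesis by (simp only: power2_eq_iff_nonneg norm_ge_zero mult_nonneg_nonneg)
qed

lemma norm_cinner_le: "cmod (cinner x y) \<le> norm x * norm (y :: 'h::complex_inner)"
proof (cases "cinner x y = 0")
  case False
  define c where "c = cnj (cinner x y)"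
  have "(cmod c)\<^sup>2 = Re (cinner (scaleC c x) y)"
    by (simp add: cinner_scaleC_left c_def complex_mult_cnj cmod_power2 flip: power2_eq_square)
  also have "\<dots> \<le> norm (scaleC c x) * norm y"
    by (simp add: Re_cinner norm_cauchy_schwarz)
  finally have "cmod c * cmod c \<le> cmod c * (norm x * norm y)"
    by (simp add: norm_scaleC power2_eq_square mult_ac)
  moreover have "cmod c > 0" using False by (simp add: c_def)
  ultimately have "cmod c \<le> norm x * norm y" by simp
  then show ?thesis by (simp add: c_def)
qed simp

lemma cinner_span_eq_zero:
  assumes "\<And>g. g \<in> G \<Longrightarrow> cinner x g = 0" "p \<in> cspan G"
  shows "cinner x p = 0"
  using assms(2)
  by (induction rule: complex_vector.span_induct_alt)
    (simp_all add: cinner_add_right cinner_scaleC_right assms(1))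

text \<open>Gram--Schmidt: a new generator \<open>a\<close> is replaced by its component \<open>a'\<close> orthogonal to the old
  ones. If \<open>a' = 0\<close>, then \<open>c = 0\<close> by the convention for division by zero, and the old projection
  already works.\<close>

lemma orthogonal_projection_exists:
  fixes G :: "'h::complex_inner set"
  assumes "finite G"
  shows "\<exists>p\<in>cspan G. \<forall>g\<in>G. cinner (x - p) g = 0"
  using assms
proof (induction G arbitrary: x)
  case (insert a G)
  obtain p where p: "p \<in> cspan G" "\<And>g. g \<in> G \<Longrightarrow> cinner (x - p) g = 0"
    using insert.IH[of x] by blast
  obtain b where b: "b \<in> cspan G" "\<And>g. g \<in> G \<Longrightarrow> cinner (a - b) g = 0"
    using insert.IH[of a] by blast
  let ?G = "insert a G"
  define a' where "a' = a - b"
  define c where "c = cinner x a' / cinner a' a'"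
  have sub: "cspan G \<subseteq> cspan ?G" by (rule complex_vector.span_mono) blast
  have a'_span: "a' \<in> cspan ?G"
    using sub b(1) by (auto simp: a'_def intro: complex_vector.span_diff complex_vector.span_base)
  have "cinner p a' = 0"
    using cinner_span_eq_zero[of G a' p] b(2) p(1) cinner_eq_zero_commute by (metis a'_def)
  moreover have "cinner x a' = c * cinner a' a'"
    by (cases "a' = 0") (simp_all add: c_def cinner_self)
  ultimately have ca': "cinner (x - (p + scaleC c a')) a' = 0"
    by (simp add: cinner_diff_left cinner_add_left cinner_scaleC_left)
  have cG: "cinner (x - (p + scaleC c a')) g = 0" if "g \<in> G" for g
    using p(2)[OF that] b(2)[OF that]
    by (simp add: cinner_diff_left cinner_add_left cinner_scaleC_left a'_def)
  have "cinner (x - (p + scaleC c a')) a = 0"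
    using ca' cinner_span_eq_zero[OF cG b(1)] cinner_add_right[of _ a' b]
    by (simp add: a'_def)
  moreover have "p + scaleC c a' \<in> cspan ?G"
    using p(1) sub a'_span by (auto intro: complex_vector.span_add complex_vector.span_scale)
  ultimately show ?case using cG by blast
qed simp

lemma unit_vector_orthogonal_to_finite:
  fixes G :: "'h::complex_inner set"
  assumes infinite_dim: "\<not> (\<exists>B::'h set. finite B \<and> cspan B = UNIV)" and "finite G"
  shows "\<exists>v. cinner v v = 1 \<and> (\<forall>g\<in>G. cinner g v = 0)"
proof -
  obtain x where x: "x \<notin> cspan G" using infinite_dim \<open>finite G\<close> by blast
  obtain p where p: "p \<in> cspan G" "\<forall>g\<in>G. cinner (x - p) g = 0"
    using orthogonal_projection_exists[OF \<open>finite G\<close>] by blast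
  have "x - p \<noteq> 0" using x p(1) by auto
  then have "cinner (sgn (x - p)) (sgn (x - p)) = 1"
    by (simp add: cinner_self norm_sgn)
  moreover have "cinner g (sgn (x - p)) = 0" if "g \<in> G" for g
  proof -
    have "cinner g (x - p) = 0" using p(2) that cinner_eq_zero_commute by blast
    then show ?thesis by (simp only: sgn_div_norm cinner_scaleR_right mult_zero_right)
  qed
  ultimately show ?thesis by blast
qed

definition orthonormal_upto :: "nat \<Rightarrow> (nat \<Rightarrow> 'h::complex_inner) \<Rightarrow> bool" where
  "orthonormal_upto N e \<longleftrightarrow> (\<forall>i<N. \<forall>j<N. cinner (e i) (e j) = (if i = j then 1 else 0))"

lemma norm_orthonormal_upto:
  assumes "orthonormal_upto N e" "i < N"
  shows "norm (e i) = 1"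
proof -
  have "complex_of_real ((norm (e i))\<^sup>2) = 1"
    unfolding cinner_self[symmetric] using assms by (simp add: orthonormal_upto_def)
  then have "(norm (e i))\<^sup>2 = 1" by (simp only: of_real_eq_1_iff)
  then show ?thesis using norm_ge_zero[of "e i"] by (auto simp: power2_eq_1_iff)
qed

lemma orthonormal_upto_orthogonal_to_finite:
  fixes G :: "'h::complex_inner set"
  assumes infinite_dim: "\<not> (\<exists>B::'h set. finite B \<and> cspan B = UNIV)" and "finite G"
  shows "\<exists>e. orthonormal_upto N e \<and> (\<forall>g\<in>G. \<forall>i<N. cinner g (e i) = 0)"
proof (induction N)
  case (Suc N)
  then obtain e where e: "orthonormal_upto N e" "\<forall>g\<in>G. \<forall>i<N. cinner g (e i) = 0" by blast
  obtain v where v: "cinner v v = 1" "\<forall>g\<in>G \<union> e ` {..<N}. cinner g v = 0"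
    using unit_vector_orthogonal_to_finite[OF infinite_dim, of "G \<union> e ` {..<N}"] \<open>finite G\<close>
    by auto
  have "\<forall>i<N. cinner (e i) v = 0 \<and> cinner v (e i) = 0"
    using v(2) cinner_eq_zero_commute by blast
  then have "orthonormal_upto (Suc N) (e(N := v))"
    using e(1) v(1) by (auto simp: orthonormal_upto_def less_Suc_eq)
  moreover have "\<forall>g\<in>G. \<forall>i<Suc N. cinner g ((e(N := v)) i) = 0"
    using e(2) v(2) by (auto simp: less_Suc_eq)
  ultimately show ?case by blast
qed (simp add: orthonormal_upto_def)

lemma cinner_sum_right: "cinner y (\<Sum>i\<in>I. f i) = (\<Sum>i\<in>I. cinner y (f i))"
  by (induction I rule: infinite_finite_induct) (simp_all add: cinner_add_right)

lemma norm_sq_orthonormal_sum: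
  assumes "orthonormal_upto N e"
  shows "(norm (\<Sum>i<N. scaleC (a i) (e i)))\<^sup>2 = (\<Sum>i<N. (cmod (a i))\<^sup>2)"
proof -
  let ?s = "\<Sum>i<N. scaleC (a i) (e i)"
  have "complex_of_real ((norm ?s)\<^sup>2) = cinner ?s ?s" by (rule cinner_self[symmetric])
  also have "\<dots> = (\<Sum>i<N. \<Sum>j<N. a i * (cnj (a j) * cinner (e i) (e j)))"
    by (simp only: cinner_sum_left cinner_scaleC_left)
      (simp only: cinner_sum_right cinner_scaleC_right sum_distrib_left)
  also have "\<dots> = (\<Sum>i<N. \<Sum>j<N. if j = i then a i * cnj (a i) else 0)"
    using assms by (intro sum.cong refl) (auto simp: orthonormal_upto_def)
  also have "\<dots> = complex_of_real (\<Sum>i<N. (cmod (a i))\<^sup>2)"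
    by (simp add: complex_norm_square del: of_real_power)
  finally show ?thesis by (simp only: of_real_eq_iff)
qed

section \<open>Operators built from an orthonormal system\<close>

lemma scaleC_scaleR: "scaleC c (r *\<^sub>R x) = r *\<^sub>R scaleC c x"
  by (simp only: scaleC_scaleC mult.commute flip: scaleC_of_real)

lemma bounded_ops_id: "id_blinfun \<in> bounded_ops"
  by (simp add: bounded_ops_def)

lemma bounded_ops_add: "S \<in> bounded_ops \<Longrightarrow> T \<in> bounded_ops \<Longrightarrow> S + T \<in> bounded_ops"
  by (simp add: bounded_ops_def blinfun.add_left scaleC_add_right)

lemma bounded_ops_scaleR: "T \<in> bounded_ops \<Longrightarrow> r *\<^sub>R T \<in> bounded_ops"
  by (simp add: bounded_ops_def blinfun.scaleR_left scaleC_scaleR)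

lemma bounded_ops_compose: "S \<in> bounded_ops \<Longrightarrow> T \<in> bounded_ops \<Longrightarrow> S o\<^sub>L T \<in> bounded_ops"
  by (simp add: bounded_ops_def)

lemma bounded_ops_sum: "(\<And>i. i \<in> I \<Longrightarrow> T i \<in> bounded_ops) \<Longrightarrow> (\<Sum>i\<in>I. T i) \<in> bounded_ops"
  by (induction I rule: infinite_finite_induct)
    (auto simp: bounded_ops_add, simp_all add: bounded_ops_def)

definition rank_one :: "'h::complex_inner \<Rightarrow> 'h \<Rightarrow> 'h \<Rightarrow>\<^sub>L 'h" where
  "rank_one u v = Blinfun (\<lambda>x. scaleC (cinner x u) v)"

lemma rank_one_apply: "blinfun_apply (rank_one u v) x = scaleC (cinner x u) v"
proof -
  have "bounded_linear (\<lambda>x. scaleC (cinner x u) v)"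
  proof (rule bounded_linear_intro)
    show "norm (scaleC (cinner x u) v) \<le> norm x * (norm u * norm v)" for x
      using mult_right_mono[OF norm_cinner_le[of x u], of "norm v"]
      by (simp add: norm_scaleC mult_ac)
    show "scaleC (cinner (r *\<^sub>R x) u) v = r *\<^sub>R scaleC (cinner x u) v" for r x
      by (simp only: cinner_scaleR_left scaleC_of_real flip: scaleC_scaleC)
  qed (simp add: cinner_add_left scaleC_add_left)
  then show ?thesis by (simp add: rank_one_def bounded_linear_Blinfun_apply)
qed

lemma bounded_ops_rank_one: "rank_one u v \<in> bounded_ops"
  by (simp add: bounded_ops_def rank_one_apply cinner_scaleC_left scaleC_scaleC)

text \<open>The projection onto the orthogonal complement of \<open>e 0, \<dots>, e (N - 1)\<close>.\<close>

definition coproj :: "nat \<Rightarrow> (nat \<Rightarrow> 'h::complex_inner) \<Rightarrow> 'h \<Rightarrow>\<^sub>L 'h" where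
  "coproj N e = id_blinfun - (\<Sum>i<N. rank_one (e i) (e i))"

definition shift :: "nat \<Rightarrow> (nat \<Rightarrow> 'h::complex_inner) \<Rightarrow> 'h \<Rightarrow>\<^sub>L 'h" where
  "shift N e = (\<Sum>i<N. rank_one (e i) (e (Suc i)))"

lemma coproj_apply: "blinfun_apply (coproj N e) x = x - (\<Sum>i<N. scaleC (cinner x (e i)) (e i))"
  by (simp add: coproj_def blinfun.diff_left blinfun.sum_left rank_one_apply)

lemma shift_apply: "blinfun_apply (shift N e) x = (\<Sum>i<N. scaleC (cinner x (e i)) (e (Suc i)))"
  by (simp add: shift_def blinfun.sum_left rank_one_apply)

lemma bounded_ops_coproj: "coproj N e \<in> bounded_ops"
  unfolding coproj_def
  by (intro bounded_ops_diff bounded_ops_id bounded_ops_sum bounded_ops_rank_one)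

lemma bounded_ops_shift: "shift N e \<in> bounded_ops"
  unfolding shift_def by (intro bounded_ops_sum bounded_ops_rank_one)

lemma cinner_coproj:
  "cinner (blinfun_apply (coproj N e) x) y = cinner x (blinfun_apply (coproj N e) y)"
  by (simp add: coproj_apply cinner_diff_left cinner_diff_right cinner_sum_left cinner_sum_right
      cinner_scaleC_left cinner_scaleC_right mult.commute flip: cinner_commute)

lemma coproj_fixes:
  assumes "\<And>i. i < N \<Longrightarrow> cinner y (e i) = 0"
  shows "blinfun_apply (coproj N e) y = y"
  using assms by (simp add: coproj_apply)

lemma coproj_kills:
  assumes "orthonormal_upto N e" "j < N"
  shows "blinfun_apply (coproj N e) (e j) = 0"
proof -
  have "(\<Sum>i<N. scaleC (cinner (e j) (e i)) (e i)) = (\<Sum>i<N. if i = j then e j else 0)"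
    using assms by (intro sum.cong refl) (auto simp: orthonormal_upto_def)
  then show ?thesis using assms(2) by (simp add: coproj_apply)
qed

lemma norm_sq_coproj:
  assumes "orthonormal_upto N e"
  shows "(norm x)\<^sup>2 = (norm (blinfun_apply (coproj N e) x))\<^sup>2 + (\<Sum>i<N. (cmod (cinner x (e i)))\<^sup>2)"
proof -
  let ?p = "blinfun_apply (coproj N e) x" and ?q = "\<Sum>i<N. scaleC (cinner x (e i)) (e i)"
  have "cinner ?p (e i) = 0" if "i < N" for i
    by (simp add: cinner_coproj coproj_kills[OF assms that])
  then have "cinner ?p ?q = 0" by (simp add: cinner_sum_right cinner_scaleC_right)
  then have "inner ?p ?q = 0" by (simp flip: Re_cinner)
  then have "(norm (?p + ?q))\<^sup>2 = (norm ?p)\<^sup>2 + (norm ?q)\<^sup>2"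
    by (simp add: orthogonal_def norm_add_Pythagorean)
  then show ?thesis by (simp add: norm_sq_orthonormal_sum[OF assms]) (simp add: coproj_apply)
qed

text \<open>The two summands have orthogonal ranges and depend on orthogonal components of the argument, so
  the norm of the sum is the maximum of the two norms and not their sum.\<close>

lemma norm_compression_plus_shift_le:
  assumes e: "orthonormal_upto (Suc N) e" and T: "norm T \<le> M"
  shows "norm ((coproj (Suc N) e o\<^sub>L T o\<^sub>L coproj (Suc N) e) + M *\<^sub>R shift N e) \<le> M"
proof (rule norm_blinfun_bound)
  show M: "0 \<le> M" using T norm_ge_zero order_trans by blast
  fix x
  let ?P = "blinfun_apply (coproj (Suc N) e)"
  let ?y = "?P (blinfun_apply T (?P x))" and ?z = "blinfun_apply (shift N e) x"
  have "cinner ?y (e i) = 0" if "i < Suc N" for i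
    by (simp add: cinner_coproj coproj_kills[OF e that])
  then have "cinner ?y ?z = 0"
    by (simp add: shift_apply cinner_sum_right cinner_scaleC_right)
  then have "inner ?y (M *\<^sub>R ?z) = 0" by (simp only: cinner_scaleR_right flip: Re_cinner) simp
  then have "(norm (?y + M *\<^sub>R ?z))\<^sup>2 = (norm ?y)\<^sup>2 + M\<^sup>2 * (norm ?z)\<^sup>2"
    by (simp add: orthogonal_def norm_add_Pythagorean power_mult_distrib)
  also have "(norm ?y)\<^sup>2 \<le> M\<^sup>2 * (norm (?P x))\<^sup>2"
  proof -
    have "(norm ?y)\<^sup>2 \<le> (norm (blinfun_apply T (?P x)))\<^sup>2"
      using norm_sq_coproj[OF e, of "blinfun_apply T (?P x)"] by (simp add: sum_nonneg)
    also have "\<dots> \<le> (M * norm (?P x))\<^sup>2"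
      using norm_blinfun_le[OF T]
      by (intro power_mono) simp_all
    finally show ?thesis by (simp add: power_mult_distrib)
  qed
  also have "(norm ?z)\<^sup>2 \<le> (\<Sum>i<Suc N. (cmod (cinner x (e i)))\<^sup>2)"
  proof -
    have "orthonormal_upto N (\<lambda>i. e (Suc i))"
      using e by (simp add: orthonormal_upto_def)
    then show ?thesis by (simp add: shift_apply norm_sq_orthonormal_sum)
  qed
  finally have "(norm (?y + M *\<^sub>R ?z))\<^sup>2 \<le> M\<^sup>2 * (norm (?P x))\<^sup>2
      + M\<^sup>2 * (\<Sum>i<Suc N. (cmod (cinner x (e i)))\<^sup>2)"
    by (simp add: mult_left_mono)
  also have "\<dots> = (M * norm x)\<^sup>2"
    by (simp add: norm_sq_coproj[OF e, of x] power_mult_distrib distrib_left)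
  finally have "norm (?y + M *\<^sub>R ?z) \<le> M * norm x"
    by (rule power2_le_imp_le) (simp add: M)
  then show "norm (blinfun_apply ((coproj (Suc N) e o\<^sub>L T o\<^sub>L coproj (Suc N) e) + M *\<^sub>R shift N e) x)
      \<le> M * norm x"
    by (simp add: blinfun.add_left blinfun.scaleR_left)
qed

section \<open>Density of operators with small backward orbits of the adjoint\<close>

text \<open>The operator is \<open>B = (1 - t) D + \<eta> \<langle>\<cdot>, h\<rangle> e\<^sub>0\<close>, where \<open>D\<close> is the compression of \<open>T0\<close> to the
  orthogonal complement of the chain \<open>e\<close> plus \<open>M\<close> times the forward shift along the chain. The
  compression does not change \<open>T0\<close> or its adjoint on \<open>F\<close>, because the chain is orthogonal to \<open>F\<close>
  and to the images of \<open>F\<close> under both. The factor \<open>1 - t\<close> makes room in the ball for the coupling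
  term. The adjoint of \<open>B\<close> sends \<open>e\<^sub>0\<close> to \<open>\<eta> h\<close> and \<open>e\<^sub>j\<^sub>+\<^sub>1\<close> to \<open>c e\<^sub>j\<close> with \<open>c = (1 - t) M > 1\<close>, so
  \<open>h\<close> has the exact backward orbit \<open>u (n + 1) = e\<^sub>n / (\<eta> c\<^sup>n)\<close>, which tends to \<open>0\<close>. The rate depends on
  \<open>t\<close> and \<open>\<eta>\<close> but not on the chain; hence \<open>q\<close> can be chosen before the length \<open>k q + 1\<close> of the
  chain.\<close>

lemma small_backward_orbit_perturbation:
  fixes T0 :: "'h::{complex_inner, complete_space} \<Rightarrow>\<^sub>L 'h"
  assumes infinite_dim: "\<not> (\<exists>B::'h set. finite B \<and> cspan B = UNIV)"
    and "M > 1" and T0: "T0 \<in> bounded_ops_ball M" and F: "finite F" and "\<epsilon> > 0"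
  shows "\<exists>B \<in> bounded_ops_ball M \<inter> sot_star_nbhd T0 F \<epsilon>. \<exists>q>0. \<exists>u. u 0 = h \<and>
    (\<forall>n\<in>{q..k * q}. real k * norm (u n) \<le> 1) \<and>
    (\<forall>j<k * q. blinfun_apply (hadjoint B) (u (Suc j)) = u j)"
proof -
  have T0_ops: "T0 \<in> bounded_ops" and T0_norm: "norm T0 \<le> M"
    using T0 by (auto simp: bounded_ops_ball_def)
  define K where "K = 1 + (\<Sum>x\<in>insert h F. norm x)"
  have K_ge: "norm x \<le> K" if "x \<in> insert h F" for x
    using member_le_sum[OF that, of norm] F by (simp add: K_def)
  have "K > 0" using sum_nonneg[of "insert h F" norm] by (simp add: K_def add_pos_nonneg)
  (* The first bound on t gives c > 1 below; the second keeps the total error, which is at most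
     2 t M K at a vector of F, below \<epsilon>. *)
  define t where "t = min ((M - 1) / (2 * M)) (\<epsilon> / (4 * M * K))"
  have "t > 0" using \<open>M > 1\<close> \<open>K > 0\<close> \<open>\<epsilon> > 0\<close> by (simp add: t_def)
  have "t * (2 * M) \<le> M - 1" and "t * (4 * M * K) \<le> \<epsilon>"
    using \<open>M > 1\<close> \<open>K > 0\<close> by (simp_all add: t_def flip: pos_le_divide_eq)
  define c where "c = (1 - t) * M"
  have c: "c > 1" using \<open>t * (2 * M) \<le> M - 1\<close> \<open>M > 1\<close> by (simp add: c_def algebra_simps)
  have t_small: "2 * (t * M * K) < \<epsilon>"
    using \<open>t * (4 * M * K) \<le> \<epsilon>\<close> \<open>\<epsilon> > 0\<close> by (simp add: algebra_simps)
  have "t < 1" using c \<open>M > 1\<close> unfolding c_def by (smt (verit) mult_nonneg_nonneg mult_minus_left)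
  (* Chosen such that the coupling term has norm at most t M, the room left by the factor 1 - t. *)
  define \<eta> where "\<eta> = t * M / K"
  have \<eta>: "\<eta> > 0" using \<open>t > 0\<close> \<open>M > 1\<close> \<open>K > 0\<close> by (simp add: \<eta>_def)
  have \<eta>h: "\<eta> * norm h \<le> t * M"
  proof -
    have "\<eta> * norm h \<le> \<eta> * K" using K_ge[of h] \<eta> by (intro mult_left_mono) auto
    then show ?thesis using \<open>K > 0\<close> by (simp add: \<eta>_def)
  qed
  obtain p where p: "real k / \<eta> < c ^ p" using real_arch_pow[OF c] by blast
  define q where "q = Suc p"
  define N where "N = k * q"
  define G where "G = insert h F \<union> blinfun_apply T0 ` F \<union> blinfun_apply (hadjoint T0) ` F"
  have "finite G" using F by (simp add: G_def)
  then obtain e where e: "orthonormal_upto (Suc N) e"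
    and Ge: "\<And>g i. g \<in> G \<Longrightarrow> i < Suc N \<Longrightarrow> cinner g (e i) = 0"
    using orthonormal_upto_orthogonal_to_finite[OF infinite_dim, of G "Suc N"] by blast
  have eG: "cinner (e i) g = 0" if "g \<in> G" "i < Suc N" for g i
    using Ge[OF that] cinner_eq_zero_commute by blast
  have ee: "cinner (e i) (e j) = (if i = j then 1 else 0)" if "i \<le> N" "j \<le> N" for i j
    using e that by (simp add: orthonormal_upto_def)
  let ?P = "coproj (Suc N) e"
  define D where "D = (?P o\<^sub>L T0 o\<^sub>L ?P) + M *\<^sub>R shift N e"
  define B where "B = (1 - t) *\<^sub>R D + \<eta> *\<^sub>R rank_one h (e 0)"
  have D_apply: "blinfun_apply D x = blinfun_apply ?P (blinfun_apply T0 (blinfun_apply ?P x))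
      + M *\<^sub>R blinfun_apply (shift N e) x" for x
    by (simp add: D_def blinfun.add_left blinfun.scaleR_left)
  have B_apply: "blinfun_apply B x = (1 - t) *\<^sub>R blinfun_apply D x + \<eta> *\<^sub>R scaleC (cinner x h) (e 0)"
    for x by (simp add: B_def blinfun.add_left blinfun.scaleR_left rank_one_apply)
  have B_ops: "B \<in> bounded_ops"
    unfolding B_def D_def
    by (intro bounded_ops_add bounded_ops_scaleR bounded_ops_compose bounded_ops_coproj
        bounded_ops_shift bounded_ops_rank_one T0_ops)
  have P_fix: "blinfun_apply ?P g = g" if "g \<in> G" for g
    by (rule coproj_fixes) (rule Ge[OF that])
  have P_kill: "blinfun_apply ?P (e j) = 0" if "j \<le> N" for j
    by (rule coproj_kills[OF e]) (use that in simp)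
  have "norm (e 0) = 1" by (rule norm_orthonormal_upto[OF e]) simp
  have B_norm: "norm B \<le> M"
  proof (rule norm_blinfun_bound)
    fix x
    have "norm (blinfun_apply D x) \<le> M * norm x"
      unfolding D_def by (rule norm_blinfun_le[OF norm_compression_plus_shift_le[OF e T0_norm]])
    then have 1: "norm ((1 - t) *\<^sub>R blinfun_apply D x) \<le> (1 - t) * (M * norm x)"
      using \<open>t < 1\<close> by simp
    have "norm (\<eta> *\<^sub>R scaleC (cinner x h) (e 0)) = \<eta> * cmod (cinner x h)"
      using \<eta> \<open>norm (e 0) = 1\<close> by (simp add: norm_scaleC)
    also have "\<dots> \<le> \<eta> * (norm x * norm h)"
      using \<eta> norm_cinner_le by (intro mult_left_mono) auto
    also have "\<dots> = (\<eta> * norm h) * norm x" by simp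
    also have "\<dots> \<le> (t * M) * norm x" using \<eta>h by (intro mult_right_mono) auto
    finally have 2: "norm (\<eta> *\<^sub>R scaleC (cinner x h) (e 0)) \<le> t * M * norm x" .
    have "norm (blinfun_apply B x) \<le> (1 - t) * (M * norm x) + t * M * norm x"
      unfolding B_apply using 1 2 by (rule norm_triangle_mono)
    then show "norm (blinfun_apply B x) \<le> M * norm x" by (simp add: algebra_simps)
  qed (use \<open>M > 1\<close> in simp)
  (* The adjoint of B is read off from this formula by inserting elements of F and of the chain. *)
  have cinner_B: "cinner (blinfun_apply B x) y =
      complex_of_real (1 - t) * (cinner x (blinfun_apply ?P (blinfun_apply (hadjoint T0) (blinfun_apply ?P y)))
        + complex_of_real M * (\<Sum>i<N. cinner x (e i) * cinner (e (Suc i)) y))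
      + complex_of_real \<eta> * (cinner x h * cinner (e 0) y)" for x y
    by (simp add: B_apply D_apply cinner_add_left cinner_scaleR_left cinner_scaleC_left cinner_coproj
        cinner_hadjoint[OF T0_ops] shift_apply cinner_sum_left)
  have adj_F: "blinfun_apply (hadjoint B) y = (1 - t) *\<^sub>R blinfun_apply (hadjoint T0) y"
    if y: "y \<in> F" for y
  proof (rule hadjoint_eqI[OF B_ops])
    fix x
    have G: "y \<in> G" "blinfun_apply (hadjoint T0) y \<in> G" using y by (auto simp: G_def)
    have "(\<Sum>i<N. cinner x (e i) * cinner (e (Suc i)) y) = 0"
      by (intro sum.neutral) (simp add: eG[OF G(1)])
    then show "cinner (blinfun_apply B x) y = cinner x ((1 - t) *\<^sub>R blinfun_apply (hadjoint T0) y)"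
      by (simp add: cinner_B P_fix G eG[OF G(1)] cinner_scaleR_right)
  qed
  have adj_e0: "blinfun_apply (hadjoint B) (e 0) = \<eta> *\<^sub>R h"
  proof (rule hadjoint_eqI[OF B_ops])
    fix x
    have "(\<Sum>i<N. cinner x (e i) * cinner (e (Suc i)) (e 0)) = 0"
      by (intro sum.neutral) (simp add: ee)
    then show "cinner (blinfun_apply B x) (e 0) = cinner x (\<eta> *\<^sub>R h)"
      by (simp add: cinner_B P_kill ee cinner_scaleR_right)
  qed
  have adj_e: "blinfun_apply (hadjoint B) (e (Suc j)) = c *\<^sub>R e j" if j: "j < N" for j
  proof (rule hadjoint_eqI[OF B_ops])
    fix x
    have "(\<Sum>i<N. cinner x (e i) * cinner (e (Suc i)) (e (Suc j)))
        = (\<Sum>i<N. if i = j then cinner x (e j) else 0)"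
      using j by (intro sum.cong refl) (auto simp: ee)
    then show "cinner (blinfun_apply B x) (e (Suc j)) = cinner x (c *\<^sub>R e j)"
      using j by (simp add: cinner_B P_kill ee cinner_scaleR_right c_def)
  qed
  have "B \<in> sot_star_nbhd T0 F \<epsilon>"
    unfolding sot_star_nbhd_def
  proof (intro CollectI conjI ballI B_ops)
    fix x assume x: "x \<in> F"
    have G: "x \<in> G" "blinfun_apply T0 x \<in> G" using x by (auto simp: G_def)
    have MK: "M * norm x \<le> M * K" using K_ge[of x] x \<open>M > 1\<close> by (intro mult_left_mono) auto
    have "blinfun_apply (shift N e) x = 0"
      by (simp add: shift_apply Ge[OF G(1)])
    then have "blinfun_apply (B - T0) x = \<eta> *\<^sub>R scaleC (cinner x h) (e 0) - t *\<^sub>R blinfun_apply T0 x"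
      by (simp add: blinfun.diff_left B_apply D_apply P_fix G scaleR_left_diff_distrib)
    also have "norm \<dots> \<le> norm (\<eta> *\<^sub>R scaleC (cinner x h) (e 0)) + norm (t *\<^sub>R blinfun_apply T0 x)"
      by (rule norm_triangle_ineq4)
    also have "\<dots> \<le> t * M * K + t * M * K"
    proof (rule add_mono)
      have "norm (\<eta> *\<^sub>R scaleC (cinner x h) (e 0)) \<le> \<eta> * (norm x * norm h)"
        using \<eta> \<open>norm (e 0) = 1\<close> norm_cinner_le by (simp add: norm_scaleC)
      also have "\<dots> = (\<eta> * norm h) * norm x" by simp
      also have "\<dots> \<le> (t * M) * K"
        using K_ge[of x] x \<open>t > 0\<close> \<open>M > 1\<close> by (intro mult_mono[OF \<eta>h]) auto
      finally show "norm (\<eta> *\<^sub>R scaleC (cinner x h) (e 0)) \<le> t * M * K" .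
      have "norm (blinfun_apply T0 x) \<le> M * K"
        using norm_blinfun_le[OF T0_norm] MK
        by (rule order_trans)
      then show "norm (t *\<^sub>R blinfun_apply T0 x) \<le> t * M * K"
        using \<open>t > 0\<close> by (simp add: mult.assoc)
    qed
    also have "\<dots> < \<epsilon>" using t_small by linarith
    finally show "norm (blinfun_apply (B - T0) x) < \<epsilon>" .
    have "blinfun_apply (hadjoint (B - T0)) x = - t *\<^sub>R blinfun_apply (hadjoint T0) x"
      by (simp add: hadjoint_diff[OF B_ops T0_ops] blinfun.diff_left adj_F[OF x]
          scaleR_left_diff_distrib)
    then have "norm (blinfun_apply (hadjoint (B - T0)) x) = t * norm (blinfun_apply (hadjoint T0) x)"
      using \<open>t > 0\<close> by simp
    also have "\<dots> \<le> t * (M * K)"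
    proof (rule mult_left_mono)
      show "norm (blinfun_apply (hadjoint T0) x) \<le> M * K"
        using order_trans[OF norm_hadjoint_le[OF T0_ops] mult_right_mono[OF T0_norm norm_ge_zero]] MK
        by (rule order_trans)
    qed (use \<open>t > 0\<close> in simp)
    also have "t * (M * K) = t * M * K" by simp
    also have "t * M * K < \<epsilon>"
    proof -
      have "t * M * K > 0" using \<open>t > 0\<close> \<open>M > 1\<close> \<open>K > 0\<close> by simp
      then show ?thesis using t_small by linarith
    qed
    finally show "norm (blinfun_apply (hadjoint (B - T0)) x) < \<epsilon>" .
  qed
  moreover have "B \<in> bounded_ops_ball M" using B_ops B_norm by (simp add: bounded_ops_ball_def)
  moreover
  define u where "u = rec_nat h (\<lambda>n _. (1 / (\<eta> * c ^ n)) *\<^sub>R e n)"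
  have u: "u 0 = h" "u (Suc n) = (1 / (\<eta> * c ^ n)) *\<^sub>R e n" for n by (simp_all add: u_def)
  have "real k * norm (u n) \<le> 1" if n: "n \<in> {q..k * q}" for n
  proof -
    obtain m where m: "n = Suc m" "p \<le> m" "m < N" using n by (cases n) (auto simp: q_def N_def)
    have "norm (e m) = 1" by (rule norm_orthonormal_upto[OF e]) (use m in simp)
    have "real k / \<eta> < c ^ m" using p power_increasing[OF m(2), of c] c by linarith
    then have "real k \<le> \<eta> * c ^ m" using \<eta> by (simp add: pos_divide_less_eq mult.commute)
    moreover have "\<eta> * c ^ m > 0" using \<eta> c by simp
    ultimately show ?thesis using \<open>norm (e m) = 1\<close> by (simp add: m u abs_of_pos)
  qed
  moreover have "blinfun_apply (hadjoint B) (u (Suc j)) = u j" if j: "j < k * q" for j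
  proof (cases j)
    case 0
    then show ?thesis using \<eta> by (simp add: u blinfun.scaleR_right adj_e0)
  next
    case (Suc i)
    then have "i < N" using j by (simp add: N_def)
    then show ?thesis using \<eta> c by (simp add: Suc u blinfun.scaleR_right adj_e)
  qed
  ultimately show ?thesis using u(1) by (auto intro!: bexI[of _ B] exI[of _ q] exI[of _ u] simp: q_def)
qed

text \<open>Every non-empty open set contains an operator with an exact small backward orbit of \<open>h\<close> under its
  adjoint, and all operators that are close enough to it on this orbit expand along \<open>h\<close>.\<close>

lemma not_expands_along_nowhere_dense:
  fixes h :: "'h::{complex_inner, complete_space}"
  assumes infinite_dim: "\<not> (\<exists>B::'h set. finite B \<and> cspan B = UNIV)" and "M > 1"
    and S: "S \<subseteq> bounded_ops_ball M" "\<And>T. T \<in> S \<Longrightarrow> \<not> expands_along k h (blinfun_apply T)"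
  shows "nowhere_dense_in (subtopology sot_star (bounded_ops_ball M)) S"
proof -
  let ?L = "bounded_ops_ball M :: ('h \<Rightarrow>\<^sub>L 'h) set"
  let ?X = "subtopology sot_star ?L"
  have top: "topspace ?X = ?L"
    by (auto simp: topspace_sot_star bounded_ops_ball_def)
  have "?X interior_of (?X closure_of S) = {}"
  proof (rule ccontr)
    assume "?X interior_of (?X closure_of S) \<noteq> {}"
    then obtain T0 W where W: "openin ?X W" "T0 \<in> W" "W \<subseteq> ?X closure_of S"
      unfolding interior_of_def by blast
    then obtain V where V: "openin sot_star V" "W = V \<inter> ?L"
      by (auto simp: openin_subtopology)
    then have T0: "T0 \<in> V" "T0 \<in> ?L" using W(2) by auto
    then obtain F \<epsilon> where F: "finite F" "\<epsilon> > 0" "sot_star_nbhd T0 F \<epsilon> \<subseteq> V"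
      using V(1) unfolding openin_sot_star by blast
    obtain B q u where B: "B \<in> ?L" "B \<in> sot_star_nbhd T0 F \<epsilon>" and q: "q > 0" and u: "u 0 = h"
      "\<forall>n\<in>{q..k * q}. real k * norm (u n) \<le> 1"
      "\<forall>j<k * q. blinfun_apply (hadjoint B) (u (Suc j)) = u j"
      using small_backward_orbit_perturbation[OF infinite_dim \<open>M > 1\<close> T0(2) F(1,2), of h k] by blast
    have B_ops: "B \<in> bounded_ops" using B(1) by (simp add: bounded_ops_ball_def)
    define a where "a = real k * (real (k * q) * M ^ (k * q))"
    have "a \<ge> 0" using \<open>M > 1\<close> by (simp add: a_def)
    (* a \<delta> bounds k times the accumulated error of a \<delta>-pseudo-orbit with at most k q steps. *)
    define \<delta> where "\<delta> = 1 / (a + 1)"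
    have \<delta>: "\<delta> > 0" "a * \<delta> \<le> 1" using \<open>a \<ge> 0\<close> by (simp_all add: \<delta>_def)
    define N where "N = sot_star_nbhd B ((\<lambda>j. u (Suc j)) ` {..<k * q}) \<delta>"
    have "openin sot_star N"
      unfolding N_def by (rule openin_sot_star_nbhd[OF B_ops]) simp
    then have "openin ?X (W \<inter> N)"
      using W(1) V(1) unfolding V(2) openin_subtopology by blast
    moreover have "hadjoint (B - B) = 0" unfolding hadjoint_diff[OF B_ops B_ops] by simp
    then have "B \<in> N"
      using \<delta>(1) B_ops by (simp add: N_def sot_star_nbhd_def)
    then have "B \<in> W \<inter> N" using B F(3) V(2) by blast
    moreover have "B \<in> ?X closure_of S" using \<open>B \<in> W \<inter> N\<close> W(3) by blast
    ultimately obtain T where T: "T \<in> S" "T \<in> N"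
      unfolding in_closure_of by blast
    have T_ops: "T \<in> bounded_ops" using T S(1) by (auto simp: bounded_ops_ball_def)
    have "expands_along k h (blinfun_apply T)"
    proof (rule expands_along_of_adjoint_pseudo_orbit[where M = M and u = u and q = q and \<delta> = \<delta>])
      show "norm (blinfun_apply (hadjoint T) (u (Suc j)) - u j) \<le> \<delta>" if j: "j < k * q" for j
        using T(2) j u(3)
        by (auto simp: N_def sot_star_nbhd_def hadjoint_diff T_ops B_ops blinfun.diff_left
            intro: less_imp_le)
      show "real k * (real (k * q) * M ^ (k * q) * \<delta>) \<le> 1"
        using \<delta>(2) by (simp add: a_def mult.assoc)
    qed (use T S(1) \<open>M > 1\<close> q u \<delta> in auto)
    then show False using S(2) T(1) by blast
  qed
  then show ?thesis using S(1) top by (simp add: nowhere_dense_in_def)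
qed

theorem corollary7p1:
  fixes M :: real
  assumes separable: "separable_space (euclidean :: 'h::{complex_inner, complete_space} topology)"
    and infinite_dim: "\<not> (\<exists>B::'h set. finite B \<and> cspan B = UNIV)"
    and "M > 1"
  shows "meager_in (subtopology sot_star (bounded_ops_ball M))
           {T \<in> (bounded_ops_ball M :: ('h \<Rightarrow>\<^sub>L 'h) set). RRec T - {0} \<noteq> {}}"
proof -
  obtain D :: "'h set" where D: "countable D" "closure D = UNIV"
    using separable by (auto simp: separable_space_def)
  let ?S = "{T \<in> (bounded_ops_ball M :: ('h \<Rightarrow>\<^sub>L 'h) set). RRec T - {0} \<noteq> {}}"
  define bad where "bad = (\<lambda>(k, h). {T \<in> ?S. \<not> expands_along k h (blinfun_apply T)})"
  let ?I = "(UNIV :: nat set) \<times> D"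
  have "countable (bad ` ?I)" using D(1) by simp
  moreover have "\<forall>A\<in>bad ` ?I. nowhere_dense_in (subtopology sot_star (bounded_ops_ball M)) A"
    by (auto simp: bad_def intro!: not_expands_along_nowhere_dense[OF infinite_dim \<open>M > 1\<close>])
  moreover have "?S = \<Union>(bad ` ?I)"
  proof
    show "?S \<subseteq> \<Union>(bad ` ?I)"
    proof
      fix T assume T: "T \<in> ?S"
      then obtain k h where "h \<in> D" "\<not> expands_along k h (blinfun_apply T)"
        using RRec_trivial_of_expands_along[OF D(2), of T] by auto
      then have "T \<in> bad (k, h)" using T by (simp add: bad_def)
      then show "T \<in> \<Union>(bad ` ?I)" using \<open>h \<in> D\<close> by blast
    qed
  qed (auto simp: bad_def)
  ultimately show ?thesis unfolding meager_in_def by blast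
qed

end
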